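(* Let $\mathcal{T}$ be the search tree built by the hybrid search algorithm, with exact heuristic $h^{\mathrm{opt}}$, global approximation $h^{\mathcal{G}}$, local approximations $h^{\mathcal{L}}_{x_0}$ (with gradient error bound $E>0$ on the neighborhoods $\mathrm{U}_d(x_0)$) and balanced heuristic $h^{\mathcal{B}}$ as defined in the context. Let $\nu_0,\nu_1,\dots,\nu_K$ be a path of length $K$ in $\mathcal{T}$ obtained via the hybrid search algorithm (so $\nu_{k}$ is the parent of $\nu_{k+1}$), write $h^{\bullet}_k=h^{\bullet}(\nu_k)$ for $\bullet\in\{\mathcal{B},\mathcal{G},\mathrm{opt}\}$, and let $\lambda_k\in[0,1]$ be the weighting factor used in computing $h^{\mathcal{B}}_k$, $k=1,\dots,K$. Let $\epsilon>0$. If $$\lambda_k\le\frac{h^{\mathcal{G}}_k}{EJ/\epsilon+\Delta c_m+h^{\mathcal{G}}_k}\qquad\text{for all }k=1,\dots,K,$$ then $$h^{\mathcal{B}}_{k+1}\le(1+\epsilon)\,h^{\mathrm{opt}}_{k+1}\qquad\text{for all }k=0,\dots,K-1,$$ i.e. the heuristic cost is at most $(1+\epsilon)$ times the minimum cost.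
   Context: **System.** $\mathcal{X}\subset\mathbb{R}^X$ is the state space, $\mathcal{X}_{\mathrm{safe}}\subset\mathcal{X}$ the set of allowed states, $\mathcal{X}_G\subset\mathcal{X}$ the goal set of the task, and $\mathcal{R}_m$ the fixed coalition of agents executing it. There is a finite set $\Xi$ of modes; each mode $\xi\in\Xi$ has a parameter set $\mathcal{P}_\xi$ and a closed-loop dynamics $x(t+1)=h_\xi(x(t),\mathcal{R}_m,\rho)$, $\rho\in\mathcal{P}_\xi$. A fixed number $T_0\in\mathbb{N}$, $T_0>0$, of time steps is executed per mode/parameter choice, and $c_{\mathrm{cont}}$ is the stage cost function, with values in $\mathbb{R}^+$. **Search tree.** $\mathcal{T}=(V,E_{\mathcal{T}},\nu_0,V_G)$ has vertices $V\subset\mathcal{X}_{\mathrm{safe}}$ (vertices are identified with states), root $\nu_0$, and goal vertices $V_G$ determined by $\mathcal{X}_G$. Each edge $(\nu,\nu^+)$ arises by expansion: for some mode $\xi$ and parameter $\rho\in\mathcal{P}_\xi$, $\mathbf{x}_0=\nu$, $\mathbf{x}_{t+1}=h_\xi(\mathbf{x}_t,\mathcal{R}_m,\rho)$ and $\nu^+=\mathbf{x}_{T_0}$. Then $\nu$ is the parent of $\nu^+$, $prev(\nu^+)=\nu$, and $cost(\nu^+)=cost(\nu)+\sum_{t=0}^{T_0}c_{\mathrm{cont}}(\mathbf{x}_t,\rho)$. The algorithm is an $A^\star$-type search: it repeatedly selects an open vertex minimizing $cost(\nu)+h^{\mathcal{B}}(\nu)$ and expands it with candidate modes and parameters. **Heuristics.**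 - $h^{\mathrm{opt}}:\mathcal{X}\to\mathbb{R}^+$ is the exact heuristic: $h^{\mathrm{opt}}(\nu)$ is the minimum accumulated cost of reaching the goal set $\mathcal{X}_G$ from $\nu$, over finite sequences of expansions, where one expansion takes a current state $x$ to a new state $x^+\in\mathcal{X}_{\mathrm{safe}}$ by choosing a mode $\xi\in\Xi$ and a parameter $\rho\in\mathcal{P}_\xi$ and setting $\mathbf{x}_0=x$, $\mathbf{x}_{t+1}=h_\xi(\mathbf{x}_t,\mathcal{R}_m,\rho)$ and $x^+=\mathbf{x}_{T_0}$ (with the cost of each expansion being $\sum_{t=0}^{T_0}c_{\mathrm{cont}}(\mathbf{x}_t,\rho)$). It is differentiable. - $h^{\mathcal{G}}:\mathcal{X}\to\mathbb{R}^+$ is the global approximation, satisfying $h^{\mathrm{opt}}(x)\ge h^{\mathcal{G}}(x)$ for all $x\in\mathcal{X}$. - For each $x_0$, $h^{\mathcal{L}}_{x_0}$ is a differentiable local approximation with $$\|\nabla h^{\mathcal{L}}_{x_0}(x)-\nabla h^{\mathrm{opt}}(x)\|\le E\quad\text{for all }x\in\mathrm{U}_d(x_0)=\{x\in\mathcal{X}:\|x-x_0\|\le d\},$$ where $d>0$ and $E>0$ are fixed. - For a vertex $\nu$ with parent $\tilde\nu=prev(\nu)$, the estimated change of cost is $$\Delta h^{\mathcal{L}}(\tilde\nu,\nu)=\sum_{\ell=1}^{L}\big(h^{\mathcal{L}}_{x_\ell}(x_\ell)-h^{\mathcal{L}}_{x_\ell}(x_{\ell-1})\big),$$ accumulated along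 a path $x_0=\tilde\nu,x_1,\dots,x_L=\nu$ with $x_\ell\in\mathrm{U}_d(x_{\ell-1})$ for $\ell=1,\dots,L$. - The balanced heuristic is defined recursively by $h^{\mathcal{B}}(\nu_0)=h^{\mathcal{G}}(\nu_0)$ at the root and $$h^{\mathcal{B}}(\nu)=\lambda\big(h^{\mathcal{B}}(\tilde\nu)+\Delta h^{\mathcal{L}}(\tilde\nu,\nu)\big)+(1-\lambda)h^{\mathcal{G}}(\nu),\qquad \tilde\nu=prev(\nu),$$ where $\lambda\in[0,1]$ is a weighting factor, denoted $\lambda_k$ when $\nu=\nu_k$. **Constants.** $J$ is the maximum distance between a vertex and its parent vertex, measured along the path $x_0,\dots,x_L$ used in $\Delta h^{\mathcal{L}}$ (i.e. $\sum_{\ell}\|x_\ell-x_{\ell-1}\|\le J$). $\Delta c_m$ is an upper bound on the cost increment along an edge: $cost(\nu_{k+1})-cost(\nu_k)<\Delta c_m$ for all $k$.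
   Formalization: The straight segments between consecutive points of each path x_0,…,x_L used in the estimated change of cost are assumed to lie in the state space; without this the claim fails, e.g. when the state space has two components at distance less than d. *)

theory Defs
  imports "HOL-Analysis.Analysis"
begin

text \<open>
  \<open>dyn S \<xi> x R \<rho>\<close> is the closed-loop successor $h_\xi(x,R,\rho)$; the letters \<open>h\<close> are kept for
  the heuristics.  All parameter sets live in one type \<open>'p\<close>.
\<close>

record ('a, 'm, 'p, 'g) hsys =
  states :: "'a set"
  safe :: "'a set"
  goal :: "'a set"
  coalition :: "'g set"
  modes :: "'m set"
  params :: "'m \<Rightarrow> 'p set"
  dyn :: "'m \<Rightarrow> 'a \<Rightarrow> 'g set \<Rightarrow> 'p \<Rightarrow> 'a"
  steps :: nat
  stage_cost :: "'a \<Rightarrow> 'p \<Rightarrow> real"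

text \<open>
  Since the exact heuristic vanishes on the goal set, the codomain $\mathbb{R}^+$ of costs and
  heuristics is read as the set of nonnegative reals throughout.
\<close>

definition wf_system :: "('a, 'm, 'p, 'g) hsys \<Rightarrow> bool" where
  "wf_system S \<longleftrightarrow>
     safe S \<subseteq> states S \<and> goal S \<subseteq> states S \<and> finite (modes S) \<and> steps S > 0 \<and>
     (\<forall>x \<rho>. 0 \<le> stage_cost S x \<rho>)"

fun trajectory :: "('a, 'm, 'p, 'g) hsys \<Rightarrow> 'm \<Rightarrow> 'p \<Rightarrow> 'a \<Rightarrow> nat \<Rightarrow> 'a" where
  "trajectory S \<xi> \<rho> x 0 = x"
| "trajectory S \<xi> \<rho> x (Suc t) = dyn S \<xi> (trajectory S \<xi> \<rho> x t) (coalition S) \<rho>"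

definition expansion :: "('a, 'm, 'p, 'g) hsys \<Rightarrow> 'm \<Rightarrow> 'p \<Rightarrow> 'a \<Rightarrow> 'a \<Rightarrow> bool" where
  "expansion S \<xi> \<rho> x x' \<longleftrightarrow>
     \<xi> \<in> modes S \<and> \<rho> \<in> params S \<xi> \<and> x' = trajectory S \<xi> \<rho> x (steps S) \<and> x' \<in> safe S"

definition expansion_cost :: "('a, 'm, 'p, 'g) hsys \<Rightarrow> 'm \<Rightarrow> 'p \<Rightarrow> 'a \<Rightarrow> real" where
  "expansion_cost S \<xi> \<rho> x = (\<Sum>t = 0..steps S. stage_cost S (trajectory S \<xi> \<rho> x t) \<rho>)"

text \<open>\<open>cost_to_goal S x c\<close>: some finite sequence of expansions leads from \<open>x\<close> into the goal set
  at accumulated cost \<open>c\<close>.\<close>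

inductive cost_to_goal :: "('a, 'm, 'p, 'g) hsys \<Rightarrow> 'a \<Rightarrow> real \<Rightarrow> bool" for S where
  at_goal: "x \<in> goal S \<Longrightarrow> cost_to_goal S x 0"
| expand: "expansion S \<xi> \<rho> x x' \<Longrightarrow> cost_to_goal S x' c \<Longrightarrow>
     cost_to_goal S x (expansion_cost S \<xi> \<rho> x + c)"

definition exact_heuristic :: "('a, 'm, 'p, 'g) hsys \<Rightarrow> ('a \<Rightarrow> real) \<Rightarrow> bool" where
  "exact_heuristic S h \<longleftrightarrow>
     (\<forall>x\<in>states S. cost_to_goal S x (h x) \<and> (\<forall>c. cost_to_goal S x c \<longrightarrow> h x \<le> c))"

text \<open>
  The heuristics are functions on the state space only, so derivatives are taken within it; at
  interior points this is the usual gradient.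
\<close>

definition has_gradient_on :: "('a::real_inner \<Rightarrow> real) \<Rightarrow> ('a \<Rightarrow> 'a) \<Rightarrow> 'a set \<Rightarrow> bool" where
  "has_gradient_on f g X \<longleftrightarrow> (\<forall>x\<in>X. (f has_derivative (\<lambda>v. g x \<bullet> v)) (at x within X))"

definition nbhd :: "('a::real_normed_vector, 'm, 'p, 'g) hsys \<Rightarrow> real \<Rightarrow> 'a \<Rightarrow> 'a set" where
  "nbhd S d x0 = {x \<in> states S. norm (x - x0) \<le> d}"

text \<open>
  The list $[x_0,\dots,x_L]$ of way points from \<open>u\<close> to \<open>v\<close>.  The polygonal path through them has to
  stay in the state space: gradients on the state space say nothing about increments across a gap.
\<close>

definition local_path ::
    "('a::real_normed_vector, 'm, 'p, 'g) hsys \<Rightarrow> real \<Rightarrow> 'a \<Rightarrow> 'a \<Rightarrow> 'a list \<Rightarrow> bool" where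
  "local_path S d u v xs \<longleftrightarrow>
     xs \<noteq> [] \<and> hd xs = u \<and> last xs = v \<and>
     (\<forall>l\<in>{1..<length xs}. xs ! l \<in> nbhd S d (xs ! (l - 1)) \<and>
        closed_segment (xs ! (l - 1)) (xs ! l) \<subseteq> states S)"

definition path_len :: "'a::real_normed_vector list \<Rightarrow> real" where
  "path_len xs = (\<Sum>l = 1..<length xs. norm (xs ! l - xs ! (l - 1)))"

definition delta_local :: "('a \<Rightarrow> 'a \<Rightarrow> real) \<Rightarrow> 'a list \<Rightarrow> real" where
  "delta_local hL xs = (\<Sum>l = 1..<length xs. hL (xs ! l) (xs ! l) - hL (xs ! l) (xs ! (l - 1)))"

text \<open>
  Every vertex other than the root carries the data of its incoming edge: parent, mode, parameter,
  way points and weighting factor.  \<open>hB\<close> holds the balanced heuristic, \<open>opn\<close> the open vertices.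
\<close>

record ('a, 'm, 'p) tree =
  verts :: "'a set"
  tree_root :: 'a
  prev :: "'a \<Rightarrow> 'a"
  edge_mode :: "'a \<Rightarrow> 'm"
  edge_param :: "'a \<Rightarrow> 'p"
  waypoints :: "'a \<Rightarrow> 'a list"
  weight :: "'a \<Rightarrow> real"
  cost :: "'a \<Rightarrow> real"
  hB :: "'a \<Rightarrow> real"
  opn :: "'a set"

definition edges :: "('a, 'm, 'p) tree \<Rightarrow> ('a \<times> 'a) set" where
  "edges T = {(prev T v, v) | v. v \<in> verts T - {tree_root T}}"

text \<open>Only differences of \<open>cost\<close> are ever compared, so its value at the root is left open.\<close>

definition search_tree ::
    "('a::real_normed_vector, 'm, 'p, 'g) hsys \<Rightarrow> ('a \<Rightarrow> real) \<Rightarrow> ('a \<Rightarrow> 'a \<Rightarrow> real) \<Rightarrow> real \<Rightarrow>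
      ('a, 'm, 'p) tree \<Rightarrow> bool" where
  "search_tree S hG hL d T \<longleftrightarrow>
     verts T \<subseteq> safe S \<and> tree_root T \<in> verts T \<and> hB T (tree_root T) = hG (tree_root T) \<and>
     edges T \<subseteq> verts T \<times> verts T \<and> (\<forall>v\<in>verts T. (tree_root T, v) \<in> (edges T)\<^sup>*) \<and>
     (\<forall>v\<in>verts T - {tree_root T}.
        expansion S (edge_mode T v) (edge_param T v) (prev T v) v \<and>
        cost T v = cost T (prev T v) +
          expansion_cost S (edge_mode T v) (edge_param T v) (prev T v) \<and>
        local_path S d (prev T v) v (waypoints T v) \<and>
        weight T v \<in> {0..1} \<and>
        hB T v = weight T v * (hB T (prev T v) + delta_local hL (waypoints T v)) +
          (1 - weight T v) * hG v)"

text \<open>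
  Vertices of \<open>T'\<close> whose incoming edge is not inherited from \<open>T\<close>: newly created ones, and known
  states for which a different incoming edge has been adopted.
\<close>

definition new_verts :: "('a, 'm, 'p) tree \<Rightarrow> ('a, 'm, 'p) tree \<Rightarrow> 'a set" where
  "new_verts T T' = {v \<in> verts T' - {tree_root T'}.
     \<not> (v \<in> verts T \<and> prev T' v = prev T v \<and> edge_mode T' v = edge_mode T v \<and>
        edge_param T' v = edge_param T v \<and> waypoints T' v = waypoints T v \<and>
        weight T' v = weight T v)}"

text \<open>
  One expansion of \<open>\<nu>\<close> with an arbitrary set of candidates.  It is left open whether \<open>\<nu>\<close> is closed
  afterwards and whether a state that is reached again keeps its incoming edge; in either case
  \<open>cost\<close> and \<open>hB\<close> satisfy their recursions on the new tree.
\<close>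

definition expansion_step :: "'a \<Rightarrow> ('a, 'm, 'p) tree \<Rightarrow> ('a, 'm, 'p) tree \<Rightarrow> bool" where
  "expansion_step \<nu> T T' \<longleftrightarrow>
     tree_root T' = tree_root T \<and> cost T' (tree_root T) = cost T (tree_root T) \<and> verts T \<subseteq> verts T' \<and>
     (\<forall>v\<in>new_verts T T'. prev T' v = \<nu>) \<and>
     opn T - {\<nu>} \<union> new_verts T T' \<subseteq> opn T' \<and> opn T' \<subseteq> opn T \<union> new_verts T T'"

inductive hybrid_search ::
    "('a::real_normed_vector, 'm, 'p, 'g) hsys \<Rightarrow> ('a \<Rightarrow> real) \<Rightarrow> ('a \<Rightarrow> 'a \<Rightarrow> real) \<Rightarrow> real \<Rightarrow>
      ('a, 'm, 'p) tree \<Rightarrow> bool" for S hG hL d where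
  init: "search_tree S hG hL d T \<Longrightarrow> verts T = {tree_root T} \<Longrightarrow> opn T = {tree_root T} \<Longrightarrow>
     hybrid_search S hG hL d T"
| expand: "hybrid_search S hG hL d T \<Longrightarrow>
     \<nu> \<in> opn T \<Longrightarrow> \<forall>\<nu>'\<in>opn T. cost T \<nu> + hB T \<nu> \<le> cost T \<nu>' + hB T \<nu>' \<Longrightarrow>
     expansion_step \<nu> T T' \<Longrightarrow> search_tree S hG hL d T' \<Longrightarrow>
     hybrid_search S hG hL d T'"

end

theory Submission
  imports Defs
begin

text \<open>
  Comparing gradients along the polygonal path gives
  $\Delta h^{\mathcal L} \le h^{\mathrm{opt}}_{k+1} - h^{\mathrm{opt}}_k + EJ$, and dynamic programming gives
  $h^{\mathrm{opt}}_k \le \Delta c_m + h^{\mathrm{opt}}_{k+1}$.  If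
  $h^{\mathcal B}_k \le (1+\epsilon) h^{\mathrm{opt}}_k$, both together yield
  $h^{\mathcal B}_k + \Delta h^{\mathcal L} \le (1+\epsilon) h^{\mathrm{opt}}_{k+1} + \epsilon A$ with
  $A = EJ/\epsilon + \Delta c_m$.  The hypothesis on $\lambda_{k+1}$ says
  $\lambda_{k+1} A \le (1-\lambda_{k+1}) h^{\mathcal G}_{k+1}$, so the excess $\epsilon A$ is absorbed by the
  global part of the balanced heuristic, and the bound propagates from the root.
\<close>

lemma hybrid_search_imp_search_tree:
  "hybrid_search S hG hL d T \<Longrightarrow> search_tree S hG hL d T"
  by (induction rule: hybrid_search.induct)

lemma exact_heuristic_nonneg:
  assumes "wf_system S" "exact_heuristic S h" "x \<in> states S"
  shows "0 \<le> h x"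
proof -
  have "0 \<le> c" if "cost_to_goal S y c" for y c
    using that
  proof induction
    case (expand \<xi> \<rho> x x' c)
    then show ?case
      using assms(1) by (auto simp: expansion_cost_def wf_system_def intro!: add_nonneg_nonneg sum_nonneg)
  qed simp
  then show ?thesis
    using assms(2,3) unfolding exact_heuristic_def by blast
qed

text \<open>Prepending the expansion to an optimal sequence from \<open>x'\<close> gives a
  competitor for the minimum at \<open>x\<close>. The optimal sequence exists because
  \<open>exact_heuristic\<close> requires its value to be attained.\<close>

lemma exact_heuristic_expansion:
  assumes "wf_system S" "exact_heuristic S h" "x \<in> states S" "expansion S \<xi> \<rho> x x'"
  shows "h x \<le> expansion_cost S \<xi> \<rho> x + h x'"
proof -
  have "x' \<in> states S"
    using assms(1,4) by (auto simp: wf_system_def expansion_def)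
  then have "cost_to_goal S x (expansion_cost S \<xi> \<rho> x + h x')"
    using assms(2,4) by (auto simp: exact_heuristic_def intro: cost_to_goal.expand)
  then show ?thesis
    using assms(2,3) by (auto simp: exact_heuristic_def)
qed

text \<open>Mean value inequality for \<open>f - g\<close>, whose derivative has operator norm at
  most \<open>E\<close> by Cauchy-Schwarz. Derivatives are restricted to the segment, the convex set
  on which the inequality is applied, so \<open>X\<close> itself may be non-convex.\<close>

lemma gradient_gap_increment:
  fixes f g :: "'a::real_inner \<Rightarrow> real"
  assumes "has_gradient_on f f' X" "has_gradient_on g g' X"
    and seg: "closed_segment u v \<subseteq> X"
    and bound: "\<And>x. x \<in> closed_segment u v \<Longrightarrow> norm (f' x - g' x) \<le> E"
  shows "f v - f u \<le> g v - g u + E * norm (v - u)"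
proof -
  have "((\<lambda>x. f x - g x) has_derivative (\<lambda>w. f' x \<bullet> w - g' x \<bullet> w)) (at x within closed_segment u v)"
    if "x \<in> closed_segment u v" for x
    using assms(1,2) seg that unfolding has_gradient_on_def
    by (blast intro: has_derivative_diff has_derivative_subset)
  moreover have "onorm (\<lambda>w. f' x \<bullet> w - g' x \<bullet> w) \<le> E" if "x \<in> closed_segment u v" for x
  proof (rule onorm_bound)
    show "0 \<le> E"
      using bound[OF that] norm_ge_zero order_trans by blast
    show "norm (f' x \<bullet> w - g' x \<bullet> w) \<le> E * norm w" for w
      using Cauchy_Schwarz_ineq2[of "f' x - g' x" w] mult_right_mono[OF bound[OF that], of "norm w"]
      by (simp add: inner_diff_left)
  qed
  ultimately have "norm ((f v - g v) - (f u - g u)) \<le> E * norm (v - u)"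
    by (rule differentiable_bound[OF convex_closed_segment]) auto
  then show ?thesis
    by (auto simp: abs_le_iff)
qed

lemma delta_local_le:
  fixes S :: "('a::real_inner, 'm, 'p, 'g) hsys"
  assumes h: "has_gradient_on h g (states S)"
    and hL: "\<forall>x0\<in>states S. has_gradient_on (hL x0) (gL x0) (states S)"
    and bound: "\<forall>x0\<in>states S. \<forall>x\<in>nbhd S d x0. norm (gL x0 x - g x) \<le> E"
    and path: "local_path S d u v xs"
  shows "delta_local hL xs \<le> h v - h u + E * path_len xs"
proof -
  have "hL (xs ! l) (xs ! l) - hL (xs ! l) (xs ! (l - 1))
      \<le> h (xs ! l) - h (xs ! (l - 1)) + E * norm (xs ! l - xs ! (l - 1))"
    if l: "l \<in> {1..<length xs}" for l
  proof (rule gradient_gap_increment)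
    have near: "xs ! l \<in> states S" "norm (xs ! l - xs ! (l - 1)) \<le> d"
      and seg: "closed_segment (xs ! (l - 1)) (xs ! l) \<subseteq> states S"
      using path l by (auto simp: local_path_def nbhd_def)
    show "has_gradient_on (hL (xs ! l)) (gL (xs ! l)) (states S)"
      using hL near(1) by blast
    show "norm (gL (xs ! l) x - g x) \<le> E"
      if x: "x \<in> closed_segment (xs ! (l - 1)) (xs ! l)" for x
    proof -
      \<comment> \<open>The local model is centred at the end point \<open>xs ! l\<close> of the
        segment, so the error bound is needed around that point; no point of the segment is farther
        from it than \<open>xs ! (l - 1)\<close>.\<close>
      have "norm (x - xs ! l) \<le> d"
        using segment_bound(2)[OF x] near(2) by (simp add: norm_minus_commute)
      then show ?thesis
        using bound near(1) seg x by (auto simp: nbhd_def)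
    qed
    show "closed_segment (xs ! (l - 1)) (xs ! l) \<subseteq> states S" by (fact seg)
  qed (fact h)
  then have "delta_local hL xs
      \<le> (\<Sum>l = 1..<length xs. h (xs ! l) - h (xs ! (l - 1)) + E * norm (xs ! l - xs ! (l - 1)))"
    unfolding delta_local_def by (rule sum_mono)
  also have "\<dots> = (\<Sum>l = 1..<length xs. h (xs ! l) - h (xs ! (l - 1))) + E * path_len xs"
    by (simp add: sum.distrib sum_distrib_left path_len_def)
  also have "(\<Sum>l = 1..<length xs. h (xs ! l) - h (xs ! (l - 1))) = h v - h u"
  proof -
    from path have ne: "xs \<noteq> []" and ends: "xs ! 0 = u" "xs ! (length xs - 1) = v"
      by (auto simp: local_path_def hd_conv_nth last_conv_nth)
    \<comment> \<open>Shifting the index by one gives the telescoping form; \<open>ne\<close>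
      ensures that \<open>length xs - 1\<close> is a true predecessor.\<close>
    have "(\<Sum>l = 1..<length xs. h (xs ! l) - h (xs ! (l - 1)))
        = (\<Sum>l = 0..<length xs - 1. h (xs ! Suc l) - h (xs ! l))"
      using ne sum.shift_bounds_Suc_ivl[of "\<lambda>l. h (xs ! l) - h (xs ! (l - 1))" 0 "length xs - 1"]
      by simp
    also have "\<dots> = h v - h u"
      using sum_Suc_diff'[of 0 "length xs - 1" "\<lambda>l. h (xs ! l)"] ends by simp
    finally show ?thesis .
  qed
  finally show ?thesis .
qed

lemma balanced_step:
  fixes w \<epsilon> A B G H :: real
  assumes "0 \<le> w" "w \<le> G / (A + G)" "0 < A" "0 \<le> G" "G \<le> H" "0 < \<epsilon>"
    and B: "B \<le> (1 + \<epsilon>) * H + \<epsilon> * A"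
  shows "w * B + (1 - w) * G \<le> (1 + \<epsilon>) * H"
proof -
  \<comment> \<open>Since \<open>A + G\<close> is positive, the bound on \<open>w\<close> can be
    cleared of its denominator and rearranged.\<close>
  have absorb: "w * A \<le> (1 - w) * G"
    using assms(2-4) by (simp add: field_simps)
  have "w \<le> 1"
  proof -
    have "G / (A + G) \<le> 1" using assms(3,4) by simp
    with assms(2) show ?thesis by linarith
  qed
  have "w * B + (1 - w) * G \<le> w * ((1 + \<epsilon>) * H + \<epsilon> * A) + (1 - w) * G"
    using B assms(1) by (simp add: mult_left_mono)
  also have "\<dots> = w * ((1 + \<epsilon>) * H) + \<epsilon> * (w * A) + (1 - w) * G"
    by (simp add: algebra_simps)
  \<comment> \<open>The term \<open>(1 - w) * G\<close> now occurs once as it is and once with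
    factor \<epsilon>, in place of the excess; together they carry the factor 1 + \<epsilon>, so
    that G \<le> H finishes the estimate.\<close>
  also have "\<dots> \<le> w * ((1 + \<epsilon>) * H) + \<epsilon> * ((1 - w) * G) + (1 - w) * G"
    using absorb assms(6) by simp
  also have "\<dots> = w * ((1 + \<epsilon>) * H) + (1 - w) * ((1 + \<epsilon>) * G)"
    by (simp add: algebra_simps)
  also have "\<dots> \<le> w * ((1 + \<epsilon>) * H) + (1 - w) * ((1 + \<epsilon>) * H)"
    using assms(5,6) \<open>w \<le> 1\<close> by (intro add_left_mono mult_left_mono) auto
  also have "\<dots> = (1 + \<epsilon>) * H"
    by (simp add: algebra_simps)
  finally show ?thesis .
qed

theorem theorem1:
  fixes S :: "(real ^ 'n, 'm, 'p, 'g) hsys"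
    and T :: "(real ^ 'n, 'm, 'p) tree"
    and hopt hG :: "real ^ 'n \<Rightarrow> real"
    and hL :: "real ^ 'n \<Rightarrow> real ^ 'n \<Rightarrow> real"
    and grad_opt :: "real ^ 'n \<Rightarrow> real ^ 'n"
    and grad_L :: "real ^ 'n \<Rightarrow> real ^ 'n \<Rightarrow> real ^ 'n"
    and d E J \<Delta>c \<epsilon> :: real
    and \<nu> :: "nat \<Rightarrow> real ^ 'n" and K :: nat
  assumes "wf_system S"
    and "exact_heuristic S hopt"
    and "has_gradient_on hopt grad_opt (states S)"
    and "\<forall>x\<in>states S. 0 \<le> hG x \<and> hG x \<le> hopt x"
    and "d > 0" and "E > 0"
    and "\<forall>x0\<in>states S. has_gradient_on (hL x0) (grad_L x0) (states S)"
    and "\<forall>x0\<in>states S. \<forall>x\<in>nbhd S d x0. norm (grad_L x0 x - grad_opt x) \<le> E"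
    and "hybrid_search S hG hL d T"
    and "\<forall>v\<in>verts T - {tree_root T}. path_len (waypoints T v) \<le> J"
    and "\<nu> 0 = tree_root T" and "\<forall>k<K. (\<nu> k, \<nu> (k + 1)) \<in> edges T"
    and "\<forall>k<K. cost T (\<nu> (k + 1)) - cost T (\<nu> k) < \<Delta>c"
    and "\<epsilon> > 0"
    and "\<forall>k\<in>{1..K}. weight T (\<nu> k) \<le> hG (\<nu> k) / (E * J / \<epsilon> + \<Delta>c + hG (\<nu> k))"
  shows "\<forall>k<K. hB T (\<nu> (k + 1)) \<le> (1 + \<epsilon>) * hopt (\<nu> (k + 1))"
proof -
  note wf = assms(1) and exact = assms(2) and hG = assms(4) and \<epsilon> = assms(14)
  have tree: "search_tree S hG hL d T"
    using assms(9) by (rule hybrid_search_imp_search_tree)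
  then have verts: "v \<in> states S" if "v \<in> verts T" for v
    using that wf by (auto simp: search_tree_def wf_system_def)
  \<comment> \<open>The claim is extended to the root, which serves as the base case.\<close>
  have "hB T (\<nu> k) \<le> (1 + \<epsilon>) * hopt (\<nu> k)" if "k \<le> K" for k
    using that
  proof (induction k)
    case 0
    have root: "\<nu> 0 \<in> states S" "hB T (\<nu> 0) = hG (\<nu> 0)"
      using tree verts assms(11) by (auto simp: search_tree_def)
    \<comment> \<open>At the root \<open>hB\<close> equals \<open>hG\<close>, which is at most
      \<open>hopt\<close>; passing to (1 + \<epsilon>) times \<open>hopt\<close> uses that
      \<open>hopt\<close> is nonnegative.\<close>
    have "0 \<le> \<epsilon> * hopt (\<nu> 0)"
      using exact_heuristic_nonneg[OF wf exact root(1)] \<epsilon> by simp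
    with root hG show ?case
      by (fastforce simp: algebra_simps)
  next
    case (Suc k)
    define u v where "u = \<nu> k" and "v = \<nu> (Suc k)"
    have edge: "(u, v) \<in> edges T"
      using assms(12) Suc.prems by (simp add: u_def v_def)
    then have v: "v \<in> verts T - {tree_root T}" and u: "prev T v = u"
      by (auto simp: edges_def)
    have states: "u \<in> states S" "v \<in> states S"
      using edge tree verts by (auto simp: search_tree_def)
    let ?c = "expansion_cost S (edge_mode T v) (edge_param T v) u"
    from tree v u have exp: "expansion S (edge_mode T v) (edge_param T v) u v"
      and cost: "cost T v = cost T u + ?c"
      and path: "local_path S d u v (waypoints T v)"
      and weight: "weight T v \<in> {0..1}"
      and hB: "hB T v = weight T v * (hB T u + delta_local hL (waypoints T v)) +
          (1 - weight T v) * hG v"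
      by (auto simp: search_tree_def)
    \<comment> \<open>The signs of \<Delta>c and \<open>J\<close> come from the existence of this
      edge: its nonnegative cost lies strictly below \<Delta>c, and its nonnegative path length is
      at most \<open>J\<close>. They make the denominator in the weight bound positive.\<close>
    have "?c < \<Delta>c"
      using assms(13)[rule_format, of k] Suc.prems cost by (simp add: u_def v_def)
    moreover have "0 \<le> ?c"
      using wf by (auto simp: expansion_cost_def wf_system_def intro!: sum_nonneg)
    ultimately have \<Delta>c: "0 < \<Delta>c" by simp
    have len: "path_len (waypoints T v) \<le> J"
      using assms(10) v by blast
    have "0 \<le> path_len (waypoints T v)"
      by (simp add: path_len_def sum_nonneg)
    with len have J: "0 \<le> J" by simp
    have "delta_local hL (waypoints T v) \<le> hopt v - hopt u + E * path_len (waypoints T v)"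
      using assms(3,7,8) path by (rule delta_local_le)
    also have "\<dots> \<le> hopt v - hopt u + E * J"
      using len assms(6) by simp
    finally have delta: "delta_local hL (waypoints T v) \<le> hopt v - hopt u + E * J" .
    have "hopt u \<le> \<Delta>c + hopt v"
      using exact_heuristic_expansion[OF wf exact states(1) exp] \<open>?c < \<Delta>c\<close> by simp
    \<comment> \<open>The bound \<open>delta\<close> cancels \<open>hopt u\<close> only once, while
      the induction hypothesis contributes it 1 + \<epsilon> times; this bounds the remaining
      \<epsilon>-fold copy.\<close>
    then have "\<epsilon> * hopt u \<le> \<epsilon> * (\<Delta>c + hopt v)"
      using \<epsilon> by simp
    moreover have "hB T u \<le> (1 + \<epsilon>) * hopt u"
      using Suc by (simp add: u_def)
    moreover have "\<epsilon> * (E * J / \<epsilon> + \<Delta>c) = E * J + \<epsilon> * \<Delta>c"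
      using \<epsilon> by (simp add: field_simps)
    ultimately have "hB T u + delta_local hL (waypoints T v)
        \<le> (1 + \<epsilon>) * hopt v + \<epsilon> * (E * J / \<epsilon> + \<Delta>c)"
      using delta by (simp add: algebra_simps)
    moreover have "weight T v \<le> hG v / (E * J / \<epsilon> + \<Delta>c + hG v)"
      using assms(15) Suc.prems by (simp add: v_def)
    moreover have "0 < E * J / \<epsilon> + \<Delta>c"
      using assms(6) J \<Delta>c \<epsilon> by (simp add: add_nonneg_pos)
    ultimately have "hB T v \<le> (1 + \<epsilon>) * hopt v"
      unfolding hB using weight hG states(2) \<epsilon> by (intro balanced_step) auto
    then show ?case by (simp add: v_def)
  qed
  then show ?thesis by simp
qed

end
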